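(* The map $\rho:B_3\to (\mathbb{P}^1)^2\times\mathbb{Z}$, $\rho(g)=(\rho_1(g),\rho_2(g),\epsilon(g))$, is injective. If $g\in B_3$ has word length $L$ (in the Artin generators $\sigma_1^{\pm1},\sigma_2^{\pm1}$), then $\rho(g)$ can be computed in running time $\mathcal{O}(L)$. In particular, the word problem in the braid group $B_3$ (decide whether two given words in the generators represent the same element of $B_3$) can be solved in linear time.
   Context: The braid group $B_3$ is given by the Artin presentation $B_3=\langle \sigma_1,\sigma_2 : \sigma_1\sigma_2\sigma_1=\sigma_2\sigma_1\sigma_2\rangle$. $\mathbb{P}^1$ denotes the projective line over $\mathbb{Q}$, identified with the set of extended rational numbers $\mathbb{Q}\cup\{\infty\}$ by $[x:y]\mapsto x/y$. For integers $c_0,\dots,c_k$, $[c_0,c_1,\dots,c_k]=c_0+\cfrac{1}{c_1+\cfrac{1}{\ddots+\cfrac{1}{c_k}}}\in\mathbb{Q}\cup\{\infty\}$, computed with the conventions $\frac10=\infty$, $\frac1\infty=0$, $c+\infty=\infty$ for $c\in\mathbb{Z}$ (the integers $c_i$ may be zero or negative). For $g\in B_3$ write $g=\prod_{i=1}^n\sigma_1^{a_i}\sigma_2^{b_i}$ with $a_i,b_i\in\mathbb{Z}$, and define $\rho_1(g)=[a_1,-b_1,\dots,a_n,-b_n]\in\mathbb{P}^1$, $\rho_2(g)=[a_1,-b_1,\dots,a_{n-1},-b_{n-1},a_n]\in\mathbb{P}^1$, and $\epsilon(g)=\sum_{i=1}^n(a_i+b_i)\in\mathbb{Z}$. These values do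 not depend on the choice of word representing $g$. *)

theory Defs
  imports "HOL-Algebra.Group" "HOL-Library.Landau_Symbols"
begin

section \<open>Groups given by generators and relators\<close>

text \<open>The letter \<open>(x, True)\<close> is the generator \<open>x\<close>, and \<open>(x, False)\<close> is its inverse.\<close>

type_synonym 'x gword = "('x \<times> bool) list"

inductive_set pres_rel :: "('x gword \<times> 'x gword) set \<Rightarrow> ('x gword \<times> 'x gword) set"
  for R :: "('x gword \<times> 'x gword) set"
where
  refl: "(w, w) \<in> pres_rel R"
| sym: "(v, w) \<in> pres_rel R \<Longrightarrow> (w, v) \<in> pres_rel R"
| trans: "(u, v) \<in> pres_rel R \<Longrightarrow> (v, w) \<in> pres_rel R \<Longrightarrow> (u, w) \<in> pres_rel R"
| cancel: "(u @ [(x, e), (x, \<not> e)] @ v, u @ v) \<in> pres_rel R"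
| relator: "(r, s) \<in> R \<Longrightarrow> (u @ r @ v, u @ s @ v) \<in> pres_rel R"

definition word_class :: "('x gword \<times> 'x gword) set \<Rightarrow> 'x gword \<Rightarrow> 'x gword set" where
  "word_class R w = pres_rel R `` {w}"

definition presented_group :: "('x gword \<times> 'x gword) set \<Rightarrow> 'x gword set monoid" where
  "presented_group R =
     \<lparr>carrier = UNIV // pres_rel R,
      mult = (\<lambda>A B. \<Union>a\<in>A. \<Union>b\<in>B. word_class R (a @ b)),
      one = word_class R []\<rparr>"

lemma equiv_pres_rel: "equiv UNIV (pres_rel R)"
  by (rule equivI) (auto simp: refl_on_def intro!: symI transI
        intro: pres_rel.refl pres_rel.sym pres_rel.trans)

lemma pres_rel_context:
  "(v, w) \<in> pres_rel R \<Longrightarrow> (p @ v @ q, p @ w @ q) \<in> pres_rel R"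
proof (induction rule: pres_rel.induct)
  case (refl w)
  show ?case by (rule pres_rel.refl)
next
  case (sym v w)
  then show ?case by (blast intro: pres_rel.sym)
next
  case (trans u v w)
  then show ?case by (blast intro: pres_rel.trans)
next
  case (cancel u x e v)
  show ?case using pres_rel.cancel[of "p @ u" x e "v @ q" R] by simp
next
  case (relator r s u v)
  then show ?case using pres_rel.relator[of r s R "p @ u" "v @ q"] by simp
qed

lemma pres_rel_append:
  assumes "(a, a') \<in> pres_rel R" "(b, b') \<in> pres_rel R"
  shows "(a @ b, a' @ b') \<in> pres_rel R"
  using pres_rel_context[OF assms(1), of "[]" b] pres_rel_context[OF assms(2), of a' "[]"]
  by (auto intro: pres_rel.trans)

lemma word_class_eq_iff: "word_class R v = word_class R w \<longleftrightarrow> (v, w) \<in> pres_rel R"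
  unfolding word_class_def using eq_equiv_class_iff[OF equiv_pres_rel] by blast

lemma carrier_presented_group: "carrier (presented_group R) = range (word_class R)"
  by (auto simp: presented_group_def quotient_def word_class_def)

lemma word_class_carrier [simp]: "word_class R w \<in> carrier (presented_group R)"
  by (simp add: carrier_presented_group)

lemma one_presented_group: "\<one>\<^bsub>presented_group R\<^esub> = word_class R []"
  by (simp add: presented_group_def)

lemma mult_presented_group:
  "word_class R v \<otimes>\<^bsub>presented_group R\<^esub> word_class R w = word_class R (v @ w)"
proof -
  have "congruent2 (pres_rel R) (pres_rel R) (\<lambda>a b. word_class R (a @ b))"
    by (rule congruent2I') (simp add: word_class_eq_iff pres_rel_append)
  from UN_equiv_class2[OF equiv_pres_rel equiv_pres_rel this] show ?thesis
    by (simp add: presented_group_def word_class_def)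
qed

lemma inverse_word:
  "(map (\<lambda>(x, e). (x, \<not> e)) (rev w) @ w, []) \<in> pres_rel R"
proof (induction w)
  case Nil
  show ?case by (simp add: pres_rel.refl)
next
  case (Cons l w)
  obtain x e where l: "l = (x, e)" by (cases l)
  have "(map (\<lambda>(x, e). (x, \<not> e)) (rev w) @ [(x, \<not> e), (x, \<not> \<not> e)] @ w,
         map (\<lambda>(x, e). (x, \<not> e)) (rev w) @ w) \<in> pres_rel R"
    by (rule pres_rel.cancel)
  then show ?case using Cons.IH by (auto simp: l intro: pres_rel.trans)
qed

lemma group_presented_group: "group (presented_group R)"
proof (rule groupI)
  fix g assume "g \<in> carrier (presented_group R)"
  then obtain w where w: "g = word_class R w" by (auto simp: carrier_presented_group)
  show "\<exists>h\<in>carrier (presented_group R). h \<otimes>\<^bsub>presented_group R\<^esub> g = \<one>\<^bsub>presented_group R\<^esub>"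
    by (rule bexI[of _ "word_class R (map (\<lambda>(x, e). (x, \<not> e)) (rev w))"])
       (simp_all add: w mult_presented_group one_presented_group word_class_eq_iff inverse_word)
qed (auto simp: carrier_presented_group mult_presented_group one_presented_group)


section \<open>The braid group on three strands\<close>

datatype artin = Sigma1 | Sigma2

definition braid_relators :: "(artin gword \<times> artin gword) set" where
  "braid_relators =
     {([(Sigma1, True), (Sigma2, True), (Sigma1, True)],
       [(Sigma2, True), (Sigma1, True), (Sigma2, True)])}"

definition B3 :: "artin gword set monoid" where
  "B3 = presented_group braid_relators"

definition braid_of :: "artin gword \<Rightarrow> artin gword set" where
  "braid_of w = word_class braid_relators w"

definition sigma1 :: "artin gword set" where "sigma1 = braid_of [(Sigma1, True)]"
definition sigma2 :: "artin gword set" where "sigma2 = braid_of [(Sigma2, True)]"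

text \<open>The product of \<open>\<sigma>\<^sub>1\<^sup>a \<sigma>\<^sub>2\<^sup>b\<close> over the pairs \<open>(a, b)\<close> of a list, in order.\<close>

definition syllable_prod :: "(int \<times> int) list \<Rightarrow> artin gword set" where
  "syllable_prod ps =
     foldr (\<lambda>(a, b) g. (sigma1 [^]\<^bsub>B3\<^esub> a \<otimes>\<^bsub>B3\<^esub> sigma2 [^]\<^bsub>B3\<^esub> b) \<otimes>\<^bsub>B3\<^esub> g) ps \<one>\<^bsub>B3\<^esub>"


section \<open>The projective line and continued fractions\<close>

datatype P1 = Fin rat | Infty

fun P1_inverse :: "P1 \<Rightarrow> P1" where
  "P1_inverse (Fin q) = (if q = 0 then Infty else Fin (1 / q))"
| "P1_inverse Infty = Fin 0"

fun P1_add :: "int \<Rightarrow> P1 \<Rightarrow> P1" where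
  "P1_add c (Fin q) = Fin (of_int c + q)"
| "P1_add c Infty = Infty"

fun cfrac :: "int list \<Rightarrow> P1" where
  "cfrac [] = Infty"  \<comment> \<open>only so that \<open>cfrac [c] = c + 1 / \<infinity> = c\<close>\<close>
| "cfrac (c # cs) = P1_add c (P1_inverse (cfrac cs))"


section \<open>The map rho\<close>

text \<open>A representation \<open>g = \<Prod>\<^sub>i \<sigma>\<^sub>1\<^sup>a\<^sup>i \<sigma>\<^sub>2\<^sup>b\<^sup>i\<close> is a nonempty list of
  pairs \<open>(a\<^sub>i, b\<^sub>i)\<close>. Existence and independence of the choice, so that the definite descriptions below
  denote, are \<open>syllable_prod_surj\<close> and \<open>rho_syllable_prod\<close>.\<close>

definition cf_entries :: "(int \<times> int) list \<Rightarrow> int list" where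
  "cf_entries ps = concat (map (\<lambda>(a, b). [a, - b]) ps)"

definition rho1 :: "artin gword set \<Rightarrow> P1" where
  "rho1 g = (THE r. \<exists>ps. ps \<noteq> [] \<and> g = syllable_prod ps \<and> r = cfrac (cf_entries ps))"

definition rho2 :: "artin gword set \<Rightarrow> P1" where
  "rho2 g = (THE r. \<exists>ps. ps \<noteq> [] \<and> g = syllable_prod ps \<and> r = cfrac (butlast (cf_entries ps)))"

definition exponent_sum :: "artin gword set \<Rightarrow> int" where
  "exponent_sum g =
     (THE r. \<exists>ps. ps \<noteq> [] \<and> g = syllable_prod ps \<and> r = (\<Sum>(a, b)\<leftarrow>ps. a + b))"

definition rho :: "artin gword set \<Rightarrow> (P1 \<times> P1) \<times> int" where
  "rho g = ((rho1 g, rho2 g), exponent_sum g)"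

subsection \<open>Well-definedness\<close>

fun P1_act :: "artin \<times> bool \<Rightarrow> P1 \<Rightarrow> P1" where
  "P1_act (Sigma1, e) z = P1_add (if e then 1 else - 1) z"
| "P1_act (Sigma2, e) z = P1_inverse (P1_add (if e then - 1 else 1) (P1_inverse z))"

definition P1_acts :: "artin gword \<Rightarrow> P1 \<Rightarrow> P1" where
  "P1_acts w z = foldr P1_act w z"

definition letter_sum :: "artin gword \<Rightarrow> int" where
  "letter_sum w = (\<Sum>(x, e)\<leftarrow>w. if e then 1 else - 1)"

lemma P1_inverse_inverse [simp]: "P1_inverse (P1_inverse z) = z"
  by (cases z) auto

lemma P1_add_add [simp]: "P1_add a (P1_add b z) = P1_add (a + b) z"
  by (cases z) auto

lemma P1_add_0 [simp]: "P1_add 0 z = z"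
  by (cases z) auto

lemma P1_acts_simps [simp]:
  "P1_acts [] z = z"
  "P1_acts (l # w) z = P1_act l (P1_acts w z)"
  "P1_acts (v @ w) z = P1_acts v (P1_acts w z)"
  by (simp_all add: P1_acts_def)

lemma P1_act_cancel: "P1_act (x, e) (P1_act (x, \<not> e) z) = z"
  by (cases x; cases e) auto

lemma P1_act_braid:
  "P1_act (Sigma1, True) (P1_act (Sigma2, True) (P1_act (Sigma1, True) z)) =
   P1_act (Sigma2, True) (P1_act (Sigma1, True) (P1_act (Sigma2, True) z))"
  by (cases z) (auto simp: field_simps split: if_splits)

lemma pres_rel_invariants:
  "(v, w) \<in> pres_rel braid_relators \<Longrightarrow> P1_acts v = P1_acts w \<and> letter_sum v = letter_sum w"
proof (induction rule: pres_rel.induct)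
  case (cancel u x e v)
  show ?case by (auto simp: fun_eq_iff P1_act_cancel letter_sum_def)
next
  case (relator r s u v)
  then show ?case using P1_act_braid
    by (auto simp: fun_eq_iff letter_sum_def braid_relators_def simp del: P1_act.simps)
qed auto

definition power_word :: "artin \<Rightarrow> int \<Rightarrow> artin gword" where
  "power_word x a = replicate (nat \<bar>a\<bar>) (x, 0 \<le> a)"

definition syllable_word :: "(int \<times> int) list \<Rightarrow> artin gword" where
  "syllable_word ps = concat (map (\<lambda>(a, b). power_word Sigma1 a @ power_word Sigma2 b) ps)"

lemma group_B3: "group B3"
  unfolding B3_def by (rule group_presented_group)

lemma carrier_B3: "carrier B3 = range braid_of"
  by (auto simp: B3_def braid_of_def carrier_presented_group)

lemma braid_of_carrier [simp]: "braid_of w \<in> carrier B3"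
  by (simp add: carrier_B3)

lemma one_B3: "\<one>\<^bsub>B3\<^esub> = braid_of []"
  by (simp add: B3_def braid_of_def one_presented_group)

lemma mult_B3: "braid_of v \<otimes>\<^bsub>B3\<^esub> braid_of w = braid_of (v @ w)"
  by (simp add: B3_def braid_of_def mult_presented_group)

lemma braid_of_eq_iff: "braid_of v = braid_of w \<longleftrightarrow> (v, w) \<in> pres_rel braid_relators"
  by (simp add: braid_of_def word_class_eq_iff)

lemma inv_letter_B3: "inv\<^bsub>B3\<^esub> (braid_of [(x, True)]) = braid_of [(x, False)]"
proof -
  interpret group B3 by (rule group_B3)
  have "(([] :: artin gword) @ [(x, False), (x, \<not> False)] @ [], [] @ []) \<in> pres_rel braid_relators"
    by (rule pres_rel.cancel)
  then have "braid_of [(x, False)] \<otimes>\<^bsub>B3\<^esub> braid_of [(x, True)] = \<one>\<^bsub>B3\<^esub>"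
    by (simp add: mult_B3 one_B3 braid_of_eq_iff)
  then show ?thesis by (rule inv_equality) simp_all
qed

lemma nat_pow_B3: "braid_of [l] [^]\<^bsub>B3\<^esub> (n :: nat) = braid_of (replicate n l)"
proof -
  interpret group B3 by (rule group_B3)
  show ?thesis
    by (induction n) (simp_all add: one_B3 mult_B3 replicate_append_same)
qed

lemma int_pow_B3: "braid_of [(x, True)] [^]\<^bsub>B3\<^esub> (a :: int) = braid_of (power_word x a)"
proof -
  interpret group B3 by (rule group_B3)
  show ?thesis
    using nat_pow_inv[of "braid_of [(x, True)]" "nat (- a)"]
    by (auto simp: int_pow_def2 power_word_def inv_letter_B3 nat_pow_B3)
qed

lemma syllable_prod_word: "syllable_prod ps = braid_of (syllable_word ps)"
  by (induction ps)
     (auto simp: syllable_prod_def syllable_word_def one_B3 mult_B3 sigma1_def sigma2_def int_pow_B3)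

lemma syllable_prod_surj:
  assumes "g \<in> carrier B3"
  shows "\<exists>ps. ps \<noteq> [] \<and> g = syllable_prod ps"
proof -
  have "\<exists>ps. syllable_word ps = w" for w
  proof (induction w)
    case Nil
    show ?case by (rule exI[of _ "[]"]) (simp add: syllable_word_def)
  next
    case (Cons l w)
    then obtain ps where ps: "syllable_word ps = w" by blast
    obtain x e where l: "l = (x, e)" by (cases l)
    let ?k = "if e then 1 else - 1 :: int"
    have "syllable_word ((case x of Sigma1 \<Rightarrow> (?k, 0) | Sigma2 \<Rightarrow> (0, ?k)) # ps) = l # w"
      using ps by (cases x) (auto simp: l syllable_word_def power_word_def)
    then show ?case by blast
  qed
  moreover obtain w where "g = braid_of w" using assms by (auto simp: carrier_B3)
  ultimately obtain ps where ps: "g = syllable_prod ps" by (metis syllable_prod_word)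
  then have "g = syllable_prod ((0, 0) # ps)"
    by (simp add: syllable_prod_word syllable_word_def power_word_def)
  then show ?thesis by blast
qed

lemma P1_acts_power1: "P1_acts (power_word Sigma1 a) z = P1_add a z"
proof -
  have "P1_acts (replicate n (Sigma1, e)) z = P1_add (if e then int n else - int n) z" for n e
    by (induction n) auto
  then show ?thesis by (simp add: power_word_def)
qed

lemma P1_acts_power2:
  "P1_acts (power_word Sigma2 b) z = P1_inverse (P1_add (- b) (P1_inverse z))"
proof -
  have "P1_acts (replicate n (Sigma2, e)) z =
        P1_inverse (P1_add (if e then - int n else int n) (P1_inverse z))" for n e
    by (induction n) auto
  then show ?thesis by (simp add: power_word_def)
qed

lemma cf_entries_Cons: "cf_entries ((a, b) # ps) = a # - b # cf_entries ps"
  by (simp add: cf_entries_def)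

lemma P1_acts_Infty: "P1_acts (syllable_word ps) Infty = cfrac (cf_entries ps)"
  by (induction ps)
     (auto simp: syllable_word_def cf_entries_def P1_acts_power1 P1_acts_power2)

lemma P1_acts_zero:
  "ps \<noteq> [] \<Longrightarrow> P1_acts (syllable_word ps) (Fin 0) = cfrac (butlast (cf_entries ps))"
proof (induction ps rule: list_nonempty_induct)
  case (single p)
  then show ?case
    by (cases p) (auto simp: syllable_word_def cf_entries_def P1_acts_power1 P1_acts_power2)
next
  case (cons p ps)
  moreover have "cf_entries ps \<noteq> []"
    using cons.hyps by (cases ps) (auto simp: cf_entries_def)
  ultimately show ?case
    by (cases p) (auto simp: cf_entries_Cons, simp add: syllable_word_def P1_acts_power1 P1_acts_power2)
qed

lemma letter_sum_syllable_word: "letter_sum (syllable_word ps) = (\<Sum>(a, b)\<leftarrow>ps. a + b)"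
  by (induction ps)
     (auto simp: syllable_word_def letter_sum_def power_word_def sum_list_replicate)

lemma rho_syllable_prod:
  assumes "ps \<noteq> []"
  shows "rho (syllable_prod ps) =
    ((cfrac (cf_entries ps), cfrac (butlast (cf_entries ps))), \<Sum>(a, b)\<leftarrow>ps. a + b)"
proof -
  have same: "P1_acts (syllable_word qs) = P1_acts (syllable_word ps) \<and>
    letter_sum (syllable_word qs) = letter_sum (syllable_word ps)"
    if "syllable_prod ps = syllable_prod qs" for qs
    using pres_rel_invariants[of "syllable_word ps" "syllable_word qs"] that
    by (simp add: syllable_prod_word braid_of_eq_iff)
  have 1: "rho1 (syllable_prod ps) = cfrac (cf_entries ps)"
    unfolding rho1_def by (rule the_equality) (use assms same in \<open>metis P1_acts_Infty\<close>)+
  have 2: "rho2 (syllable_prod ps) = cfrac (butlast (cf_entries ps))"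
    unfolding rho2_def by (rule the_equality) (use assms same in \<open>metis P1_acts_zero\<close>)+
  have 3: "exponent_sum (syllable_prod ps) = (\<Sum>(a, b)\<leftarrow>ps. a + b)"
    unfolding exponent_sum_def
    by (rule the_equality) (use assms same in \<open>metis letter_sum_syllable_word\<close>)+
  show ?thesis by (simp add: rho_def 1 2 3)
qed


section \<open>Random access machines\<close>

text \<open>The random access machine of Cook and Reckhow (Time bounded random access machines,
  J. Comput. System Sci. 7, 1973) with the unit cost criterion: registers hold arbitrary integers,
  the only arithmetic operations are addition and subtraction, and every instruction takes one
  unit of time.\<close>

datatype instr =
    Const nat int      \<comment> \<open>\<open>X\<^sub>i := c\<close>\<close>
  | Add nat nat nat    \<comment> \<open>\<open>X\<^sub>i := X\<^sub>j + X\<^sub>k\<close>\<close>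
  | Sub nat nat nat    \<comment> \<open>\<open>X\<^sub>i := X\<^sub>j - X\<^sub>k\<close>\<close>
  | Load nat nat       \<comment> \<open>\<open>X\<^sub>i := X\<^bsub>X\<^sub>j\<^esub>\<close>\<close>
  | Store nat nat      \<comment> \<open>\<open>X\<^bsub>X\<^sub>i\<^esub> := X\<^sub>j\<close>\<close>
  | JumpPos nat nat    \<comment> \<open>go to instruction \<open>m\<close> if \<open>X\<^sub>j > 0\<close>\<close>
  | Read nat           \<comment> \<open>move the next input item to \<open>X\<^sub>i\<close>\<close>
  | Print nat          \<comment> \<open>append \<open>X\<^sub>i\<close> to the output\<close>

record ram_config =
  ram_pc :: nat
  ram_reg :: "nat \<Rightarrow> int"
  ram_input :: "int list"
  ram_output :: "int list"

text \<open>A negative indirect address, or reading beyond the input, leaves the configuration unchanged,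
  so that the machine never halts.\<close>

fun ram_exec :: "instr \<Rightarrow> ram_config \<Rightarrow> ram_config" where
  "ram_exec (Const i c) s = s\<lparr>ram_pc := Suc (ram_pc s), ram_reg := (ram_reg s)(i := c)\<rparr>"
| "ram_exec (Add i j k) s =
     s\<lparr>ram_pc := Suc (ram_pc s), ram_reg := (ram_reg s)(i := ram_reg s j + ram_reg s k)\<rparr>"
| "ram_exec (Sub i j k) s =
     s\<lparr>ram_pc := Suc (ram_pc s), ram_reg := (ram_reg s)(i := ram_reg s j - ram_reg s k)\<rparr>"
| "ram_exec (Load i j) s =
     (if ram_reg s j < 0 then s
      else s\<lparr>ram_pc := Suc (ram_pc s),
             ram_reg := (ram_reg s)(i := ram_reg s (nat (ram_reg s j)))\<rparr>)"
| "ram_exec (Store i j) s =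
     (if ram_reg s i < 0 then s
      else s\<lparr>ram_pc := Suc (ram_pc s),
             ram_reg := (ram_reg s)(nat (ram_reg s i) := ram_reg s j)\<rparr>)"
| "ram_exec (JumpPos m j) s =
     s\<lparr>ram_pc := (if ram_reg s j > 0 then m else Suc (ram_pc s))\<rparr>"
| "ram_exec (Read i) s =
     (case ram_input s of
        [] \<Rightarrow> s
      | x # xs \<Rightarrow> s\<lparr>ram_pc := Suc (ram_pc s), ram_reg := (ram_reg s)(i := x), ram_input := xs\<rparr>)"
| "ram_exec (Print i) s =
     s\<lparr>ram_pc := Suc (ram_pc s), ram_output := ram_output s @ [ram_reg s i]\<rparr>"

definition ram_halted :: "instr list \<Rightarrow> ram_config \<Rightarrow> bool" where
  "ram_halted P s \<longleftrightarrow> length P \<le> ram_pc s"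

definition ram_step :: "instr list \<Rightarrow> ram_config \<Rightarrow> ram_config" where
  "ram_step P s = (if ram_halted P s then s else ram_exec (P ! ram_pc s) s)"

definition ram_init :: "int list \<Rightarrow> ram_config" where
  "ram_init xs = \<lparr>ram_pc = 0, ram_reg = (\<lambda>_. 0), ram_input = xs, ram_output = []\<rparr>"

text \<open>Halted configurations are fixed by \<open>ram_step\<close>, so this says that \<open>P\<close>, run on input \<open>xs\<close>,
  halts after at most \<open>t\<close> steps with output \<open>ys\<close>.\<close>

definition ram_outputs_within :: "instr list \<Rightarrow> int list \<Rightarrow> nat \<Rightarrow> int list \<Rightarrow> bool" where
  "ram_outputs_within P xs t ys \<longleftrightarrow>
     (let s = (ram_step P ^^ t) (ram_init xs) in ram_halted P s \<and> ram_output s = ys)"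

text \<open>Inputs \<open>x\<close> of size \<open>sz x\<close> are presented to the machine as \<open>enc x\<close>, and \<open>ans x\<close> is the
  required output.\<close>

definition computable_in_linear_time ::
  "('a \<Rightarrow> int list) \<Rightarrow> ('a \<Rightarrow> nat) \<Rightarrow> ('a \<Rightarrow> int list) \<Rightarrow> bool" where
  "computable_in_linear_time enc sz ans \<longleftrightarrow>
     (\<exists>P. \<exists>T :: nat \<Rightarrow> nat. (\<lambda>L. real (T L)) \<in> O(\<lambda>L. real L) \<and>
        (\<forall>x. ram_outputs_within P (enc x) (T (sz x)) (ans x)))"

subsection \<open>Encoding of inputs and outputs\<close>

fun encode_letter :: "artin \<times> bool \<Rightarrow> int" where
  "encode_letter (Sigma1, e) = (if e then 1 else - 1)"
| "encode_letter (Sigma2, e) = (if e then 2 else - 2)"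

text \<open>Words are terminated by \<open>0\<close>.\<close>

definition encode_word :: "artin gword \<Rightarrow> int list" where
  "encode_word w = map encode_letter w @ [0]"

text \<open>A point of the projective line is output by homogeneous coordinates in lowest terms, the
  second one being nonnegative.\<close>

fun encode_P1 :: "P1 \<Rightarrow> int list" where
  "encode_P1 (Fin q) = [fst (quotient_of q), snd (quotient_of q)]"
| "encode_P1 Infty = [1, 0]"

fun encode_rho_value :: "(P1 \<times> P1) \<times> int \<Rightarrow> int list" where
  "encode_rho_value ((p, q), e) = encode_P1 p @ encode_P1 q @ [e]"

end

theory Submission
  imports Defs
begin

text \<open>The group acts on the projective line, and \<open>\<rho>\<^sub>1(g)\<close>, \<open>\<rho>\<^sub>2(g)\<close> are the images of \<open>\<infinity>\<close>
  and \<open>0\<close>. Let \<open>\<Delta> = \<sigma>\<^sub>1 \<sigma>\<^sub>2 \<sigma>\<^sub>1\<close>, whose square is central. Up to a power of \<open>\<Delta>\<^sup>2\<close>, every braid has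
  the form \<open>\<Delta>\<^sup>i w \<Delta>\<^sup>m\<close> with \<open>i \<le> 1\<close> and \<open>w\<close> a positive word in \<open>\<sigma>\<^sub>1\<close> and \<open>\<sigma>\<^sub>2\<inverse>\<close>. As \<open>\<Delta>\<close> swaps
  \<open>0\<close> and \<open>\<infinity>\<close>, while a nonempty \<open>w\<close> moves one of them into the positive rationals, a braid that
  fixes both points is a power of \<open>\<Delta>\<close>, and exponent sum \<open>0\<close> makes it trivial.

  For the running time, the matrix of a word is built by one column operation per letter; its columns
  are homogeneous coordinates of the images of \<open>\<infinity>\<close> and \<open>0\<close>, in lowest terms since the determinant
  is \<open>1\<close>. For the word problem, the machine inverts the matrix of the first word, continues with the
  second word, and tests whether the result is diagonal and the exponent sums agree.\<close>

section \<open>Injectivity\<close>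

lemma rho_braid_of:
  "rho (braid_of w) = ((P1_acts w Infty, P1_acts w (Fin 0)), letter_sum w)"
proof -
  obtain ps where ps: "ps \<noteq> []" "braid_of w = syllable_prod ps"
    using syllable_prod_surj[OF braid_of_carrier] by blast
  then have "P1_acts w = P1_acts (syllable_word ps) \<and> letter_sum w = letter_sum (syllable_word ps)"
    by (intro pres_rel_invariants) (simp add: syllable_prod_word flip: braid_of_eq_iff)
  then show ?thesis
    by (simp add: ps rho_syllable_prod P1_acts_Infty P1_acts_zero letter_sum_syllable_word)
qed

lemma braid_of_context:
  "braid_of v = braid_of w \<Longrightarrow> braid_of (p @ v @ q) = braid_of (p @ w @ q)"
  by (simp add: braid_of_eq_iff pres_rel_context)

lemma braid_of_cancel: "braid_of (p @ (x, e) # (x, \<not> e) # q) = braid_of (p @ q)"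
  using pres_rel.cancel[of p x e q braid_relators] by (simp add: braid_of_eq_iff)

lemma braid_of_relation:
  "braid_of (p @ (Sigma1, True) # (Sigma2, True) # (Sigma1, True) # q) =
   braid_of (p @ (Sigma2, True) # (Sigma1, True) # (Sigma2, True) # q)"
  using pres_rel.relator[of _ _ braid_relators p q]
  by (simp add: braid_of_eq_iff braid_relators_def)

section \<open>The Garside element \<Delta> and the normal form built on it\<close>

definition garside :: "artin gword" where
  "garside = [(Sigma1, True), (Sigma2, True), (Sigma1, True)]"

definition garside_pow :: "nat \<Rightarrow> artin gword" where
  "garside_pow n = concat (replicate n garside)"

lemma garside_pow_simps:
  "garside_pow 0 = []"
  "garside_pow (Suc n) = garside @ garside_pow n"
  by (simp_all add: garside_pow_def)

fun swap_artin :: "artin \<Rightarrow> artin" where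
  "swap_artin Sigma1 = Sigma2"
| "swap_artin Sigma2 = Sigma1"

text \<open>For a positive letter one braid relation suffices. For an inverse letter, a cancelling
  pair of swapped letters is inserted in front and the positive case is applied inside.\<close>

lemma garside_letter: "braid_of (garside @ [(x, e)]) = braid_of ((swap_artin x, e) # garside)"
proof -
  have pos: "braid_of (garside @ [(x, True)]) = braid_of ((swap_artin x, True) # garside)" for x
    using braid_of_relation[of "[]" "[(Sigma1, True)]"] braid_of_relation[of "[(Sigma1, True)]" "[]"]
    by (cases x) (simp_all add: garside_def)
  show ?thesis
  proof (cases e)
    case True
    then show ?thesis using pos by simp
  next
    case False
    have "braid_of (garside @ [(x, False)]) =
        braid_of ((swap_artin x, False) # (swap_artin x, True) # garside @ [(x, False)])"
      using braid_of_cancel[of "[]" "swap_artin x" False "garside @ [(x, False)]"] by simp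
    also have "\<dots> = braid_of ((swap_artin x, False) # garside @ [(x, True), (x, False)])"
      using braid_of_context[OF pos, of "[(swap_artin x, False)]" x "[(x, False)]"] by simp
    also have "\<dots> = braid_of ((swap_artin x, False) # garside)"
      using braid_of_cancel[of "(swap_artin x, False) # garside" x True "[]"] by simp
    finally show ?thesis using False by simp
  qed
qed

text \<open>Passing two copies of \<Delta> swaps the generators twice, so each letter comes out
  unchanged.\<close>

lemma garside_square_central:
  "braid_of (garside @ garside @ w) = braid_of (w @ garside @ garside)"
proof (induction w)
  case (Cons l w)
  obtain x e where l: "l = (x, e)" by (cases l)
  have "braid_of (garside @ garside @ l # w) = braid_of (garside @ (swap_artin x, e) # garside @ w)"
    using braid_of_context[OF garside_letter[of x e], of garside w] by (simp add: l)
  also have "\<dots> = braid_of (l # garside @ garside @ w)"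
    using braid_of_context[OF garside_letter[of "swap_artin x" e], of "[]" "garside @ w"]
    by (cases x) (simp_all add: l)
  also have "\<dots> = braid_of (l # w @ garside @ garside)"
    using braid_of_context[OF Cons.IH, of "[l]" "[]"] by simp
  finally show ?case by simp
qed simp

text \<open>Words in \<open>\<sigma>\<^sub>1\<close> and \<open>\<sigma>\<^sub>2\<inverse>\<close>, which act on the line by \<open>z + 1\<close> and \<open>z / (z + 1)\<close> and
  hence preserve the interval from \<open>0\<close> to \<open>\<infinity>\<close>.\<close>

definition alternating :: "artin gword \<Rightarrow> bool" where
  "alternating w \<longleftrightarrow> set w \<subseteq> {(Sigma1, True), (Sigma2, False)}"

text \<open>The exponent on the right is a natural number, so a braid may first have to be
  multiplied by an even power of \<Delta>. On the left one \<Delta> is enough, because a pair is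
  central and moves to the right end.\<close>

definition garside_form :: "artin gword \<Rightarrow> bool" where
  "garside_form u \<longleftrightarrow> (\<exists>i w m. alternating w \<and>
     braid_of u = braid_of ((if i then garside else []) @ w @ garside_pow m))"

lemma garside_form_I:
  "alternating w \<Longrightarrow> braid_of u = braid_of (w @ garside_pow m) \<Longrightarrow> garside_form u"
  "alternating w \<Longrightarrow> braid_of u = braid_of (garside @ w @ garside_pow m) \<Longrightarrow> garside_form u"
  unfolding garside_form_def by (rule exI[of _ False], force) (rule exI[of _ True], force)

lemma garside_form_E:
  assumes "garside_form u"
  obtains w m where "alternating w" "braid_of u = braid_of (w @ garside_pow m)"
  | w m where "alternating w" "braid_of u = braid_of (garside @ w @ garside_pow m)"
  using assms unfolding garside_form_def by (metis append_Nil)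

lemma garside_form_garside:
  assumes "garside_form u"
  shows "garside_form (garside @ u)"
  using assms
proof (cases rule: garside_form_E)
  case (1 w m)
  then show ?thesis
    using braid_of_context[OF 1(2), of garside "[]"] by (auto intro: garside_form_I(2))
next
  case (2 w m)
  have "braid_of (garside @ u) = braid_of (w @ garside_pow (Suc (Suc m)))"
    using braid_of_context[OF 2(2), of garside "[]"]
      braid_of_context[OF garside_square_central[of w], of "[]" "garside_pow m"]
    by (simp add: garside_pow_simps)
  with 2(1) show ?thesis by (rule garside_form_I(1))
qed

text \<open>A \<Delta> caught between two alternating letters becomes a central square, absorbs both
  letters, or vanishes. The rules rest on cancelling \<open>\<sigma>\<^sub>2\<close> at an end of
  \<Delta>, written as \<open>\<sigma>\<^sub>2 \<sigma>\<^sub>1 \<sigma>\<^sub>2\<close>.\<close>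

lemma letter_garside_letter:
  "braid_of ((Sigma1, True) # garside @ [(Sigma1, True)]) = braid_of (garside @ garside @ [(Sigma2, False)])"
  "braid_of ((Sigma1, True) # garside @ [(Sigma2, False)]) = braid_of garside"
  "braid_of ((Sigma2, False) # garside @ [(Sigma1, True)]) = braid_of garside"
  "braid_of ((Sigma2, False) # garside @ [(Sigma2, False)]) = braid_of [(Sigma1, True)]"
proof -
  let ?a = "(Sigma1, True)" and ?s = "(Sigma2, True)" and ?b = "(Sigma2, False)"
  show "braid_of (?a # garside @ [?a]) = braid_of (garside @ garside @ [?b])"
    using braid_of_relation[of "[?a,?s,?a]" "[?b]"] braid_of_relation[of "[?a]" "[?a]"]
      braid_of_cancel[of "[?a,?s,?a,?s,?a]" Sigma2 True "[]"]
    by (simp add: garside_def)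
  show "braid_of (?a # garside @ [?b]) = braid_of garside"
    using braid_of_relation[of "[?a]" "[?b]"] braid_of_cancel[of "[?a,?s,?a]" Sigma2 True "[]"]
    by (simp add: garside_def)
  show "braid_of (?b # garside @ [?a]) = braid_of garside"
    using braid_of_relation[of "[?b]" "[?a]"] braid_of_cancel[of "[]" Sigma2 False "[?a,?s,?a]"]
    by (simp add: garside_def)
  show "braid_of (?b # garside @ [?b]) = braid_of [?a]"
    using braid_of_relation[of "[?b]" "[?b]"] braid_of_cancel[of "[]" Sigma2 False "[?a,?s,?b]"]
      braid_of_cancel[of "[?a]" Sigma2 True "[]"]
    by (simp add: garside_def)
qed

text \<open>A leading \<Delta> separates the new letter from \<open>w\<close>. It joins the power on
  the right if \<open>w\<close> is empty; otherwise \<open>letter_garside_letter\<close>, applied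
  with the first letter of \<open>w\<close>, restores the form.\<close>

lemma garside_form_alternating_Cons:
  assumes "garside_form u" and l: "l \<in> {(Sigma1, True), (Sigma2, False)}"
  shows "garside_form (l # u)"
  using assms(1)
proof (cases rule: garside_form_E)
  case (1 w m)
  then show ?thesis
    using braid_of_context[OF 1(2), of "[l]" "[]"] l
    by (intro garside_form_I(1)[of "l # w" _ m]) (auto simp: alternating_def)
next
  case (2 w m)
  have u: "braid_of (l # u) = braid_of (l # garside @ w @ garside_pow m)"
    using braid_of_context[OF 2(2), of "[l]" "[]"] by simp
  show ?thesis
  proof (cases w)
    case Nil
    then show ?thesis
      using u l by (intro garside_form_I(1)[of "[l]" _ "Suc m"]) (auto simp: alternating_def garside_pow_simps)
  next
    case (Cons k w')
    have w': "alternating w'" and k: "k \<in> {(Sigma1, True), (Sigma2, False)}"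
      using 2(1) Cons by (auto simp: alternating_def)
    have red: "braid_of (l # u) = braid_of (v @ w' @ garside_pow m)"
      if "braid_of (l # garside @ [k]) = braid_of v" for v
      using braid_of_context[OF that, of "[]" "w' @ garside_pow m"] by (simp add: u Cons)
    consider "l = (Sigma1, True)" "k = (Sigma1, True)" | "braid_of (l # garside @ [k]) = braid_of garside"
      | "l = (Sigma2, False)" "k = (Sigma2, False)"
      using l k letter_garside_letter by blast
    then show ?thesis
    proof cases
      case 1
      let ?w = "(Sigma2, False) # w'"
      have "braid_of (l # u) = braid_of (garside @ garside @ ?w @ garside_pow m)"
        using red[of "garside @ garside @ [(Sigma2, False)]"] letter_garside_letter 1 by simp
      also have "\<dots> = braid_of (?w @ garside_pow (Suc (Suc m)))"
        using braid_of_context[OF garside_square_central[of ?w], of "[]" "garside_pow m"]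
        by (simp add: garside_pow_simps)
      finally show ?thesis
        using w' by (intro garside_form_I(1)[of ?w]) (auto simp: alternating_def)
    next
      case 2
      from red[OF this] show ?thesis by (rule garside_form_I(2)[OF w'])
    next
      case 3
      then have "braid_of (l # u) = braid_of (((Sigma1, True) # w') @ garside_pow m)"
        using red[of "[(Sigma1, True)]"] letter_garside_letter by simp
      then show ?thesis
        by (rule garside_form_I(1)[rotated]) (use w' in \<open>simp add: alternating_def\<close>)
    qed
  qed
qed

lemma garside_form_exists: "\<exists>n. garside_form (u @ garside_pow (2 * n))"
proof (induction u)
  case Nil
  show ?case
    by (rule exI[of _ 0], rule garside_form_I(1)[of "[]" _ 0])
       (auto simp: alternating_def garside_pow_simps)
next
  case (Cons l u)
  then obtain n where n: "garside_form (u @ garside_pow (2 * n))" by blast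
  let ?u = "u @ garside_pow (2 * n)"
  show ?case
  proof (cases "l \<in> {(Sigma1, True), (Sigma2, False)}")
    case True
    then show ?thesis using garside_form_alternating_Cons[OF n] by auto
  next
    case False
    obtain x e where l: "l = (x, e)" by (cases l)
    \<comment> \<open>The two letters that are not alternating become so when the generators are
      swapped; moving past a \<Delta> does this, at the cost of one further square of
      \<Delta>.\<close>
    let ?k = "(swap_artin x, e)"
    have k: "?k \<in> {(Sigma1, True), (Sigma2, False)}"
      using False by (cases x; cases e) (auto simp: l)
    have "braid_of ((l # u) @ garside_pow (2 * Suc n)) = braid_of (l # garside @ garside @ ?u)"
      using braid_of_context[OF garside_square_central[of u], of "[l]" "garside_pow (2 * n)"]
      by (simp add: garside_pow_simps)
    also have "\<dots> = braid_of (garside @ ?k # garside @ ?u)"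
      using braid_of_context[OF garside_letter[of "swap_artin x" e], of "[]" "garside @ ?u"]
      by (cases x) (auto simp: l)
    finally have "braid_of ((l # u) @ garside_pow (2 * Suc n)) = braid_of (garside @ ?k # garside @ ?u)" .
    moreover have "garside_form (garside @ ?k # garside @ ?u)"
      by (intro garside_form_garside garside_form_alternating_Cons n k)
    ultimately show ?thesis unfolding garside_form_def by metis
  qed
qed

section \<open>The action on the ends 0 and \<infinity>\<close>

lemma P1_acts_garside: "P1_acts garside Infty = Fin 0" "P1_acts garside (Fin 0) = Infty"
  by (simp_all add: garside_def)

lemma P1_acts_garside_pow: "P1_acts (garside_pow n) ` {Fin 0, Infty} = {Fin 0, Infty}"
  by (induction n) (simp_all add: garside_pow_simps P1_acts_garside image_image[symmetric], auto)

lemma P1_acts_pow_even: "P1_acts (garside_pow (2 * n)) z = z" if "z \<in> {Fin 0, Infty}"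
  using that by (induction n) (auto simp: garside_pow_simps P1_acts_garside)

lemma P1_acts_inverse_word: "P1_acts (map (\<lambda>(x, e). (x, \<not> e)) (rev w)) (P1_acts w z) = z"
  using pres_rel_invariants[OF inverse_word[of w]] by (metis P1_acts_simps(1,3))

lemma inj_P1_acts: "inj (P1_acts w)"
  by (rule inj_on_inverseI[of _ "P1_acts (map (\<lambda>(x, e). (x, \<not> e)) (rev w))"])
    (rule P1_acts_inverse_word)

lemma alternating_nonneg:
  assumes "alternating w" "z \<in> insert Infty (Fin ` {0..})"
  shows "P1_acts w z \<in> insert Infty (Fin ` {0..})"
  using assms by (induction w) (auto simp: alternating_def split: if_splits)

text \<open>On the interval from 0 to \<infinity>, the map \<open>z + 1\<close> reaches an end only
  from \<infinity>, and \<open>z / (z + 1)\<close> only from 0. So the word behind the first letter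
  would send both ends to the same point, against injectivity.\<close>

lemma alternating_fixes_ends:
  assumes "alternating w" "P1_acts w ` {Fin 0, Infty} \<subseteq> {Fin 0, Infty}"
  shows "w = []"
proof (cases w)
  case (Cons l w')
  let ?p = "P1_acts w' (Fin 0)" and ?q = "P1_acts w' Infty"
  have w': "alternating w'" and l: "l = (Sigma1, True) \<or> l = (Sigma2, False)"
    using assms(1) Cons by (auto simp: alternating_def)
  have "?p \<in> insert Infty (Fin ` {0..})" "?q \<in> insert Infty (Fin ` {0..})"
    using alternating_nonneg[OF w'] by auto
  moreover have "P1_act l ?p \<in> {Fin 0, Infty}" "P1_act l ?q \<in> {Fin 0, Infty}"
    using assms(2) Cons by auto
  ultimately have "?p = ?q"
    using l by (elim disjE) (auto split: if_splits simp: add_nonneg_eq_0_iff add_eq_0_iff field_simps)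
  then have False using inj_eq[OF inj_P1_acts] by blast
  then show ?thesis ..
qed simp

lemma letter_sum_append: "letter_sum (v @ w) = letter_sum v + letter_sum w"
  by (simp add: letter_sum_def)

lemma letter_sum_garside_pow: "letter_sum (garside_pow n) = 3 * int n"
  by (induction n) (auto simp: garside_pow_simps letter_sum_append, simp_all add: letter_sum_def garside_def)

lemma braid_trivial:
  assumes "P1_acts u (Fin 0) = Fin 0" "P1_acts u Infty = Infty" "letter_sum u = 0"
  shows "braid_of u = braid_of []"
proof -
  obtain n where "garside_form (u @ garside_pow (2 * n))" using garside_form_exists by blast
  then obtain i w m where w: "alternating w" and
    eq: "braid_of (u @ garside_pow (2 * n)) = braid_of ((if i then garside else []) @ w @ garside_pow m)"
    unfolding garside_form_def by blast
  have inv: "P1_acts (u @ garside_pow (2 * n)) = P1_acts ((if i then garside else []) @ w @ garside_pow m)"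
    "letter_sum (u @ garside_pow (2 * n)) = letter_sum ((if i then garside else []) @ w @ garside_pow m)"
    using eq pres_rel_invariants by (simp_all only: braid_of_eq_iff)
  have acts: "P1_acts (if i then garside else []) (P1_acts w (P1_acts (garside_pow m) z)) = z"
    if "z \<in> {Fin 0, Infty}" for z
    using that fun_cong[OF inv(1), of z] assms P1_acts_pow_even[OF that] by auto
  \<comment> \<open>As \<Delta> exchanges the two ends and acts injectively, an end can only be the
    image of an end.\<close>
  have ends: "z \<in> {Fin 0, Infty}" if "P1_acts (if i then garside else []) z \<in> {Fin 0, Infty}" for z
    using that inj_eq[OF inj_P1_acts[of garside]] P1_acts_garside by (auto split: if_splits) metis+
  have "P1_acts w ` (P1_acts (garside_pow m) ` {Fin 0, Infty}) \<subseteq> {Fin 0, Infty}"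
    using acts ends by blast
  then have "w = []"
    unfolding P1_acts_garside_pow by (rule alternating_fixes_ends[OF w])
  then have w0: "(if i then garside else []) @ w @ garside_pow m = garside_pow (of_bool i + m)"
    by (simp add: garside_pow_simps)
  \<comment> \<open>Each \<Delta> contributes 3 to the exponent sum, so both sides carry the same
    power of \<Delta>, which then cancels in the group.\<close>
  then have "2 * n = of_bool i + m"
    using inv(2) assms(3) by (cases i) (simp_all add: letter_sum_append letter_sum_garside_pow)
  then have eq': "braid_of (u @ garside_pow (2 * n)) = braid_of ([] @ garside_pow (2 * n))"
    using eq w0 by simp
  interpret group B3 by (rule group_B3)
  from eq' show ?thesis by (simp flip: mult_B3 del: append_Nil)
qed

text \<open>If the invariants agree, the inverse of \<open>v\<close> followed by \<open>w\<close>
  fixes both ends and has exponent sum 0, so \<open>braid_trivial\<close> applies to it.\<close>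

lemma rho_braid_of_eq_iff: "rho (braid_of v) = rho (braid_of w) \<longleftrightarrow> braid_of v = braid_of w"
proof
  assume rho: "rho (braid_of v) = rho (braid_of w)"
  let ?i = "map (\<lambda>(x, e). (x, \<not> e)) (rev v)"
  have "letter_sum ?i + letter_sum v = 0"
    using pres_rel_invariants[OF inverse_word[of v]] by (simp add: letter_sum_append) (simp add: letter_sum_def)
  then have "braid_of (?i @ w) = braid_of []"
    using rho P1_acts_inverse_word[of v]
    by (intro braid_trivial) (simp_all add: rho_braid_of letter_sum_append, metis+)
  then have "braid_of ?i \<otimes>\<^bsub>B3\<^esub> braid_of w = braid_of ?i \<otimes>\<^bsub>B3\<^esub> braid_of v"
    using inverse_word[of v] by (simp add: mult_B3 braid_of_eq_iff) (metis pres_rel.sym pres_rel.trans)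
  then show "braid_of v = braid_of w"
    using monoid.Units_l_cancel[OF group.is_monoid[OF group_B3]] group.Units_eq[OF group_B3]
    by (metis braid_of_carrier)
qed simp

lemma inj_on_rho: "inj_on rho (carrier B3)"
  by (auto simp: inj_on_def carrier_B3 rho_braid_of_eq_iff)

section \<open>Moebius transformations\<close>

type_synonym int_matrix = "int \<times> int \<times> int \<times> int"

fun det2 :: "int_matrix \<Rightarrow> int" where
  "det2 (a, b, c, d) = a * d - b * c"

fun adjugate :: "int_matrix \<Rightarrow> int_matrix" where
  "adjugate (a, b, c, d) = (d, - b, - c, a)"

text \<open>The point with homogeneous coordinates \<open>p\<close>, \<open>q\<close>. The
  meaningless pair of zeros also yields \<open>Infty\<close>, hence the side conditions below that
  exclude it.\<close>

definition ratio :: "rat \<Rightarrow> rat \<Rightarrow> P1" where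
  "ratio p q = (if q = 0 then Infty else Fin (p / q))"

fun moebius :: "int_matrix \<Rightarrow> P1 \<Rightarrow> P1" where
  "moebius (a, b, c, d) (Fin q) = ratio (of_int a * q + of_int b) (of_int c * q + of_int d)"
| "moebius (a, b, c, d) Infty = ratio (of_int a) (of_int c)"

text \<open>Right multiplication by the matrix with rows (1, 1), (0, 1) for
  \<open>\<sigma>\<^sub>1\<close> and (1, 0), (-1, 1) for \<open>\<sigma>\<^sub>2\<close>, or by the
  inverse. The right side fits a machine that reads the word from left to right.\<close>

fun mult_letter :: "int_matrix \<Rightarrow> artin \<times> bool \<Rightarrow> int_matrix" where
  "mult_letter (a, b, c, d) (Sigma1, e) = (if e then (a, b + a, c, d + c) else (a, b - a, c, d - c))"
| "mult_letter (a, b, c, d) (Sigma2, e) = (if e then (a - b, b, c - d, d) else (a + b, b, c + d, d))"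

lemma det2_mult_letter: "det2 (mult_letter M l) = det2 M"
  by (cases "(M, l)" rule: mult_letter.cases) (auto simp: algebra_simps)

lemma det2_mult_letters: "det2 (foldl mult_letter M w) = det2 M"
  by (induction w arbitrary: M) (simp_all add: det2_mult_letter)

lemma ratio_scale: "k \<noteq> 0 \<Longrightarrow> ratio (k * p) (k * q) = ratio p q"
  by (simp add: ratio_def)

lemma ratio_exhaust:
  obtains p q where "z = ratio p q" "p \<noteq> 0 \<or> q \<noteq> 0"
proof (cases z)
  case (Fin q)
  then show ?thesis using that[of q 1] by (simp add: ratio_def)
next
  case Infty
  then show ?thesis using that[of 1 0] by (simp add: ratio_def)
qed

text \<open>In homogeneous coordinates the action is linear, which spares later computations the
  case distinction on \<infinity>.\<close>

lemma moebius_ratio: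
  assumes "p \<noteq> 0 \<or> q \<noteq> 0"
  shows "moebius (a, b, c, d) (ratio p q) =
    ratio (of_int a * p + of_int b * q) (of_int c * p + of_int d * q)"
proof (cases "q = 0")
  case True
  then show ?thesis
    using assms ratio_scale[of p "of_int a" "of_int c"] by (simp add: ratio_def[of p] mult.commute)
next
  case False
  then show ?thesis
    using ratio_scale[of q "of_int a * (p / q) + of_int b" "of_int c * (p / q) + of_int d"]
    by (simp add: ratio_def[of p] algebra_simps)
qed

lemma P1_act_ratio:
  assumes "p \<noteq> 0 \<or> q \<noteq> 0"
  shows "P1_act (Sigma1, e) (ratio p q) = ratio (if e then p + q else p - q) q"
    "P1_act (Sigma2, e) (ratio p q) = ratio p (if e then q - p else q + p)"
  using assms by (auto simp: ratio_def field_simps)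

lemma moebius_mult_letter: "moebius (mult_letter M l) z = moebius M (P1_act l z)"
proof -
  obtain a b c d where M: "M = (a, b, c, d)" by (cases M)
  obtain x e where l: "l = (x, e)" by (cases l)
  obtain p q where z: "z = ratio p q" "p \<noteq> 0 \<or> q \<noteq> 0" by (rule ratio_exhaust)
  \<comment> \<open>These are the coordinate vectors that the four letters produce;
    \<open>moebius_ratio\<close> needs them to be nonzero.\<close>
  have ne: "p + q \<noteq> 0 \<or> q \<noteq> 0" "p - q \<noteq> 0 \<or> q \<noteq> 0" "p \<noteq> 0 \<or> q - p \<noteq> 0" "p \<noteq> 0 \<or> p + q \<noteq> 0"
    using z(2) by auto
  show ?thesis
    by (cases x; cases e)
      (simp_all add: M l z(1) P1_act_ratio[OF z(2)] moebius_ratio[OF z(2)] ne[THEN moebius_ratio]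
        algebra_simps del: P1_act.simps)
qed

lemma moebius_mult_letters: "moebius (foldl mult_letter M w) z = moebius M (P1_acts w z)"
  by (induction w arbitrary: M) (simp_all add: moebius_mult_letter)

lemma moebius_one: "moebius (1, 0, 0, 1) z = z"
  by (cases z) (simp_all add: ratio_def)

lemma moebius_adjugate:
  assumes "det2 M = 1"
  shows "moebius (adjugate M) (moebius M z) = z"
proof -
  obtain a b c d where M: "M = (a, b, c, d)" by (cases M)
  have "a * d - b * c = 1" using assms by (simp add: M)
  then have det: "(of_int a * of_int d - of_int b * of_int c :: rat) = 1"
    by (metis of_int_1 of_int_diff of_int_mult)
  obtain p q where z: "z = ratio p q" "p \<noteq> 0 \<or> q \<noteq> 0" by (rule ratio_exhaust)
  define p' q' where "p' = of_int a * p + of_int b * q" and "q' = of_int c * p + of_int d * q"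
  \<comment> \<open>The adjugate times the matrix is the determinant times the identity. Recovering
    \<open>p\<close> and \<open>q\<close> also shows that \<open>p'\<close> and \<open>q'\<close>
    are not both 0.\<close>
  have "of_int d * p' - of_int b * q' = (of_int a * of_int d - of_int b * of_int c) * p"
    "of_int a * q' - of_int c * p' = (of_int a * of_int d - of_int b * of_int c) * q"
    by (simp_all add: p'_def q'_def algebra_simps)
  then have pq: "of_int d * p' - of_int b * q' = p" "of_int a * q' - of_int c * p' = q"
    by (simp_all add: det)
  then have "p' \<noteq> 0 \<or> q' \<noteq> 0" using z(2) by auto
  then show ?thesis
    using z(2) pq by (simp add: M z(1) moebius_ratio flip: p'_def q'_def)
qed

lemma moebius_adjugate_eq_iff:
  assumes "det2 M = 1"
  shows "moebius (adjugate M) z = z' \<longleftrightarrow> moebius M z' = z"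
proof -
  have "adjugate (adjugate M) = M" "det2 (adjugate M) = 1"
    using assms by (cases M; simp add: algebra_simps)+
  then show ?thesis using moebius_adjugate assms by metis
qed

text \<open>The determinant keeps \<open>d\<close> nonzero when \<open>b = 0\<close>. Fixing both
  ends thus means being diagonal, which includes minus the identity.\<close>

lemma moebius_fixes_ends:
  assumes "det2 (a, b, c, d) = 1"
  shows "moebius (a, b, c, d) Infty = Infty \<longleftrightarrow> c = 0" "moebius (a, b, c, d) (Fin 0) = Fin 0 \<longleftrightarrow> b = 0"
  using assms by (auto simp: ratio_def)

fun homogeneous_coords :: "int \<Rightarrow> int \<Rightarrow> int list" where
  "homogeneous_coords p q = (if q > 0 then [p, q] else if q < 0 then [- p, - q] else [1, 0])"

lemma encode_P1_ratio:
  "coprime p q \<Longrightarrow> encode_P1 (ratio (of_int p) (of_int q)) = homogeneous_coords p q"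
  by (auto simp: ratio_def quotient_of_Fract Rat.normalize_def coprime_iff_gcd_eq_1 simp flip: Fract_of_int_quotient)

lemma encode_P1_moebius:
  assumes "det2 (a, b, c, d) = 1"
  shows "encode_P1 (moebius (a, b, c, d) Infty) = homogeneous_coords a c"
    "encode_P1 (moebius (a, b, c, d) (Fin 0)) = homogeneous_coords b d"
proof -
  have det: "a * d - b * c = 1" using assms by simp
  \<comment> \<open>A common divisor of either column divides both products in the
    determinant.\<close>
  have "is_unit g" if "g dvd a \<and> g dvd c \<or> g dvd b \<and> g dvd d" for g
    using that det by (metis dvd_diff dvd_mult dvd_mult2)
  then have "coprime a c" "coprime b d" by (blast intro: coprimeI)+
  then show "encode_P1 (moebius (a, b, c, d) Infty) = homogeneous_coords a c"
    "encode_P1 (moebius (a, b, c, d) (Fin 0)) = homogeneous_coords b d"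
    by (simp_all add: encode_P1_ratio del: homogeneous_coords.simps)
qed

section \<open>The machine programs\<close>

text \<open>A Hoare triple with a time bound; \<open>t\<close> is only an upper bound, since the
  branches of a program differ in length.\<close>

definition ram_leads :: "instr list \<Rightarrow> nat \<Rightarrow> (ram_config \<Rightarrow> bool) \<Rightarrow> (ram_config \<Rightarrow> bool) \<Rightarrow> bool" where
  "ram_leads P t A B \<longleftrightarrow> (\<forall>s. A s \<longrightarrow> (\<exists>k\<le>t. B ((ram_step P ^^ k) s)))"

lemma ram_leadsI: "(\<And>s. A s \<Longrightarrow> \<exists>k\<le>t. B ((ram_step P ^^ k) s)) \<Longrightarrow> ram_leads P t A B"
  by (simp add: ram_leads_def)

lemma ram_leads_trans:
  assumes "ram_leads P t A B" "ram_leads P t' B C" "t'' = t + t'"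
  shows "ram_leads P t'' A C"
proof (rule ram_leadsI)
  fix s assume "A s"
  then obtain k where k: "k \<le> t" "B ((ram_step P ^^ k) s)"
    using assms(1) unfolding ram_leads_def by blast
  then obtain k' where "k' \<le> t'" "C ((ram_step P ^^ k') ((ram_step P ^^ k) s))"
    using assms(2) unfolding ram_leads_def by blast
  then show "\<exists>k\<le>t''. C ((ram_step P ^^ k) s)"
    using k assms(3) by (intro exI[of _ "k' + k"]) (simp add: funpow_add)
qed

lemma ram_outputs_withinI:
  assumes "ram_leads P t (\<lambda>s. s = ram_init xs) (\<lambda>s. ram_halted P s \<and> ram_output s = ys)" "t \<le> t'"
  shows "ram_outputs_within P xs t' ys"
proof -
  obtain k where k: "k \<le> t" "ram_halted P ((ram_step P ^^ k) (ram_init xs))"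
      "ram_output ((ram_step P ^^ k) (ram_init xs)) = ys"
    using assms(1) unfolding ram_leads_def by blast
  \<comment> \<open>A halted machine stays put, so the run can be padded to the exact step count of
    \<open>ram_outputs_within\<close>.\<close>
  have "(ram_step P ^^ n) ((ram_step P ^^ k) (ram_init xs)) = (ram_step P ^^ k) (ram_init xs)" for n
    using k(2) by (induction n) (simp_all add: ram_step_def)
  then have "(ram_step P ^^ (t' - k + k)) (ram_init xs) = (ram_step P ^^ k) (ram_init xs)"
    by (simp only: funpow_add comp_apply)
  then show ?thesis using assms(2) k by (simp add: ram_outputs_within_def)
qed

text \<open>An opaque sum, so that the simplifier computes the offset within a block of code whose
  address \<open>n\<close> is a variable.\<close>

definition loc :: "nat \<Rightarrow> nat \<Rightarrow> nat" where
  "loc n k = n + k"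

lemma Suc_loc: "Suc (loc n k) = loc n (Suc k)"
  by (simp add: loc_def)

definition code_at :: "instr list \<Rightarrow> nat \<Rightarrow> instr list \<Rightarrow> bool" where
  "code_at P n c \<longleftrightarrow> (\<exists>pre post. P = pre @ c @ post \<and> length pre = n)"

lemma ram_step_code:
  assumes "code_at P n c" "k < length c"
  shows "ram_step P \<lparr>ram_pc = loc n k, ram_reg = f, ram_input = xs, ram_output = ys\<rparr> =
    ram_exec (c ! k) \<lparr>ram_pc = loc n k, ram_reg = f, ram_input = xs, ram_output = ys\<rparr>"
  using assms by (auto simp: code_at_def ram_step_def ram_halted_def loc_def nth_append)

text \<open>Peels off the first step rather than the last, so that the simplifier runs code in
  program order.\<close>

lemma funpow_numeral: "(f ^^ numeral k) x = (f ^^ pred_numeral k) (f x)"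
  by (simp add: numeral_eq_Suc funpow_swap1)

text \<open>Register 0 holds the letter just read, registers 1 to 4 the matrix, 5 the exponent sum,
  6 and 8 the constants 1 and 0, and 7 is scratch space.\<close>

fun ram_in :: "nat \<Rightarrow> int_matrix \<Rightarrow> int \<Rightarrow> int list \<Rightarrow> int list \<Rightarrow> ram_config \<Rightarrow> bool" where
  "ram_in n (a, b, c, d) e xs ys s \<longleftrightarrow>
     ram_pc s = n \<and> ram_input s = xs \<and> ram_output s = ys \<and>
     ram_reg s 1 = a \<and> ram_reg s 2 = b \<and> ram_reg s 3 = c \<and> ram_reg s 4 = d \<and>
     ram_reg s 5 = e \<and> ram_reg s 6 = 1 \<and> ram_reg s 8 = 0"

text \<open>One round per letter: the blocks at offsets 7, 11, 17 and 21 treat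
  \<open>\<sigma>\<^sub>1\<close>, \<open>\<sigma>\<^sub>2\<close> and their inverses, and the
  terminator exits to offset 25. Jumps on register 6, which holds 1, are unconditional.\<close>

definition multiply_code :: "nat \<Rightarrow> instr list" where
  "multiply_code n =
    [Read 0,
     JumpPos (loc n 5) 0, Sub 7 8 0, JumpPos (loc n 15) 7, JumpPos (loc n 25) 6,
     Sub 7 0 6, JumpPos (loc n 11) 7,
     Add 2 2 1, Add 4 4 3, Add 5 5 6, JumpPos (loc n 0) 6,
     Sub 1 1 2, Sub 3 3 4, Add 5 5 6, JumpPos (loc n 0) 6,
     Sub 7 7 6, JumpPos (loc n 21) 7,
     Sub 2 2 1, Sub 4 4 3, Sub 5 5 6, JumpPos (loc n 0) 6,
     Add 1 1 2, Add 3 3 4, Sub 5 5 6, JumpPos (loc n 0) 6]"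

lemma multiply_code_letter:
  assumes "code_at P n (multiply_code n)"
  shows "ram_leads P 10 (ram_in (loc n 0) M e (encode_letter l # xs) ys)
    (ram_in (loc n 0) (mult_letter M l) (e + letter_sum [l]) xs ys)"
proof (rule ram_leadsI)
  note step = ram_step_code[OF assms, unfolded multiply_code_def]
  fix s :: ram_config
  assume s: "ram_in (loc n 0) M e (encode_letter l # xs) ys s"
  obtain x i where l: "l = (x, i)" by (cases l)
  obtain a b c d where M: "M = (a, b, c, d)" by (cases M)
  \<comment> \<open>An inverse letter first fails the test for positive letters, which costs two
    more steps.\<close>
  let ?k = "if i then 8 else 10"
  have "ram_in (loc n 0) (mult_letter M l) (e + letter_sum [l]) xs ys ((ram_step P ^^ ?k) s)"
    by (cases x; cases i; use s in \<open>cases s\<close>)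
      (simp add: M l step funpow_numeral Suc_loc letter_sum_def)+
  then show "\<exists>k\<le>10. ram_in (loc n 0) (mult_letter M l) (e + letter_sum [l]) xs ys ((ram_step P ^^ k) s)"
    by (intro exI[of _ ?k]) simp
qed

lemma multiply_code_word:
  assumes code: "code_at P n (multiply_code n)"
  shows "ram_leads P (10 * length w + 5) (ram_in (loc n 0) M e (encode_word w @ xs) ys)
    (ram_in (loc n 25) (foldl mult_letter M w) (e + letter_sum w) xs ys)"
proof (induction w arbitrary: M e)
  case Nil
  show ?case
  proof (rule ram_leadsI)
    note step = ram_step_code[OF assms, unfolded multiply_code_def]
    fix s
    assume s: "ram_in (loc n 0) M e (encode_word [] @ xs) ys s"
    obtain a b c d where M: "M = (a, b, c, d)" by (cases M)
    \<comment> \<open>The terminator 0 fails both sign tests and takes the unconditional jump at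
      offset 4.\<close>
    have "ram_in (loc n 25) (foldl mult_letter M []) (e + letter_sum []) xs ys ((ram_step P ^^ 5) s)"
      using s by (cases s) (simp add: M step funpow_numeral Suc_loc letter_sum_def encode_word_def)
    then show "\<exists>k\<le>10 * length [] + 5.
        ram_in (loc n 25) (foldl mult_letter M []) (e + letter_sum []) xs ys ((ram_step P ^^ k) s)"
      by (intro exI[of _ 5]) simp
  qed
next
  case (Cons l w)
  have "ram_leads P 10 (ram_in (loc n 0) M e (encode_word (l # w) @ xs) ys)
      (ram_in (loc n 0) (mult_letter M l) (e + letter_sum [l]) (encode_word w @ xs) ys)"
    using multiply_code_letter[OF code, of M e l "encode_word w @ xs" ys]
    by (simp add: encode_word_def)
  from ram_leads_trans[OF this Cons.IH] show ?case
    by (simp add: letter_sum_def add.assoc)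
qed

definition coords_code :: "nat \<Rightarrow> nat \<Rightarrow> nat \<Rightarrow> instr list" where
  "coords_code n i j =
    [JumpPos (loc n 7) j, Sub 7 8 j, JumpPos (loc n 5) 7, Const i 1, JumpPos (loc n 7) 6,
     Sub i 8 i, Sub j 8 j, Print i, Print j]"

text \<open>The sign is normalized in place, so afterwards the printed column is unknown while the
  other one is intact for the next block.\<close>

lemma coords_code_column1:
  assumes "code_at P n (coords_code n 1 3)"
  shows "ram_leads P 7 (ram_in (loc n 0) (a, b, c, d) e xs ys)
    (\<lambda>s. \<exists>a' c'. ram_in (loc n 9) (a', b, c', d) e xs (ys @ homogeneous_coords a c) s)"
proof (rule ram_leadsI)
  note step = ram_step_code[OF assms, unfolded coords_code_def]
  fix s
  assume s: "ram_in (loc n 0) (a, b, c, d) e xs ys s"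
  let ?B = "\<lambda>s. \<exists>a' c'. ram_in (loc n 9) (a', b, c', d) e xs (ys @ homogeneous_coords a c) s"
  consider "c > 0" | "c < 0" | "c = 0" by linarith
  then have "?B ((ram_step P ^^ (if c > 0 then 3 else 7)) s)"
    by cases (use s in \<open>cases s; simp add: step funpow_numeral Suc_loc\<close>)+
  then show "\<exists>k\<le>7. ?B ((ram_step P ^^ k) s)"
    by (intro exI[of _ "if c > 0 then 3 else 7"]) simp
qed

lemma coords_code_column2:
  assumes "code_at P n (coords_code n 2 4)"
  shows "ram_leads P 7 (ram_in (loc n 0) (a, b, c, d) e xs ys)
    (\<lambda>s. \<exists>b' d'. ram_in (loc n 9) (a, b', c, d') e xs (ys @ homogeneous_coords b d) s)"
proof (rule ram_leadsI)
  note step = ram_step_code[OF assms, unfolded coords_code_def]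
  fix s
  assume s: "ram_in (loc n 0) (a, b, c, d) e xs ys s"
  let ?B = "\<lambda>s. \<exists>b' d'. ram_in (loc n 9) (a, b', c, d') e xs (ys @ homogeneous_coords b d) s"
  consider "d > 0" | "d < 0" | "d = 0" by linarith
  then have "?B ((ram_step P ^^ (if d > 0 then 3 else 7)) s)"
    by cases (use s in \<open>cases s; simp add: step funpow_numeral Suc_loc\<close>)+
  then show "\<exists>k\<le>7. ?B ((ram_step P ^^ k) s)"
    by (intro exI[of _ "if d > 0 then 3 else 7"]) simp
qed

text \<open>A nonzero off-diagonal entry or exponent sum, detected by the sign of the register or of
  its negation, leads to offset 10, where 0 is printed; offset 12 prints 1.\<close>

definition zero_test_code :: "nat \<Rightarrow> instr list" where
  "zero_test_code n =
    [JumpPos (loc n 10) 2, Sub 7 8 2, JumpPos (loc n 10) 7,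
     JumpPos (loc n 10) 3, Sub 7 8 3, JumpPos (loc n 10) 7,
     JumpPos (loc n 10) 5, Sub 7 8 5, JumpPos (loc n 10) 7,
     JumpPos (loc n 12) 6, Print 8, JumpPos (loc n 13) 6, Print 6]"

lemma zero_test_code:
  assumes "code_at P n (zero_test_code n)"
  shows "ram_leads P 11 (ram_in (loc n 0) (a, b, c, d) e xs ys)
    (ram_in (loc n 13) (a, b, c, d) e xs (ys @ [if b = 0 \<and> c = 0 \<and> e = 0 then 1 else 0]))"
proof (rule ram_leadsI)
  note step = ram_step_code[OF assms, unfolded zero_test_code_def]
  fix s
  assume s: "ram_in (loc n 0) (a, b, c, d) e xs ys s"
  \<comment> \<open>Three instructions for each register found to be 0, one or three for the first
    nonzero one, and two for the answer.\<close>
  define k :: nat where "k = (if b > 0 then 3 else if b < 0 then 5 else if c > 0 then 6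
    else if c < 0 then 8 else if e > 0 then 9 else 11)"
  let ?B = "ram_in (loc n 13) (a, b, c, d) e xs (ys @ [if b = 0 \<and> c = 0 \<and> e = 0 then 1 else 0])"
  consider "b > 0" | "b < 0" | "b = 0" "c > 0" | "b = 0" "c < 0" | "b = 0" "c = 0" "e > 0"
    | "b = 0" "c = 0" "e < 0" | "b = 0" "c = 0" "e = 0" by linarith
  then have "?B ((ram_step P ^^ k) s)"
    by cases (use s in \<open>cases s; simp add: k_def step funpow_numeral Suc_loc\<close>)+
  moreover have "k \<le> 11" by (simp add: k_def)
  ultimately show "\<exists>k\<le>11. ?B ((ram_step P ^^ k) s)" by blast
qed

lemma ram_leads_weaken: "ram_leads P t A B \<Longrightarrow> (\<And>s. B s \<Longrightarrow> B' s) \<Longrightarrow> ram_leads P t A B'"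
  unfolding ram_leads_def by blast

lemma ram_leads_ex:
  "(\<And>x. ram_leads P t (A x) B) \<Longrightarrow> ram_leads P t (\<lambda>s. \<exists>x. A x s) B"
  unfolding ram_leads_def by blast

text \<open>All registers start at 0, so only the diagonal of the identity matrix and the constant 1
  have to be set.\<close>

definition init_code :: "instr list" where
  "init_code = [Const 6 1, Const 1 1, Const 4 1]"

lemma init_code:
  assumes "code_at P 0 init_code"
  shows "ram_leads P 3 (\<lambda>s. s = ram_init xs) (ram_in (loc 0 3) (1, 0, 0, 1) 0 xs [])"
proof (rule ram_leadsI)
  note step = ram_step_code[OF assms, unfolded init_code_def]
  fix s
  assume s: "s = ram_init xs"
  have s: "s = \<lparr>ram_pc = loc 0 0, ram_reg = (\<lambda>_. 0), ram_input = xs, ram_output = []\<rparr>"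
    by (simp add: s ram_init_def loc_def)
  have "ram_in (loc 0 3) (1, 0, 0, 1) 0 xs [] ((ram_step P ^^ 3) s)"
    by (simp add: s step funpow_numeral Suc_loc) (simp add: loc_def)
  then show "\<exists>k\<le>3. ram_in (loc 0 3) (1, 0, 0, 1) 0 xs [] ((ram_step P ^^ k) s)" by blast
qed

text \<open>Adding register 8 copies and subtracting from it negates; register 7 saves
  \<open>a\<close> during the exchange. Negating the exponent sum too gives the state that the
  inverse word would produce.\<close>

definition invert_code :: "instr list" where
  "invert_code = [Add 7 1 8, Add 1 4 8, Add 4 7 8, Sub 2 8 2, Sub 3 8 3, Sub 5 8 5]"

lemma invert_code:
  assumes "code_at P n invert_code"
  shows "ram_leads P 6 (ram_in (loc n 0) M e xs ys) (ram_in (loc n 6) (adjugate M) (- e) xs ys)"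
proof (rule ram_leadsI)
  note step = ram_step_code[OF assms, unfolded invert_code_def]
  fix s
  assume s: "ram_in (loc n 0) M e xs ys s"
  obtain a b c d where M: "M = (a, b, c, d)" by (cases M)
  have "ram_in (loc n 6) (adjugate M) (- e) xs ys ((ram_step P ^^ 6) s)"
    using s by (cases s) (simp add: M step funpow_numeral Suc_loc, simp add: loc_def)
  then show "\<exists>k\<le>6. ram_in (loc n 6) (adjugate M) (- e) xs ys ((ram_step P ^^ k) s)" by blast
qed

section \<open>The complete programs for \<rho> and for the word problem\<close>

definition rho_code :: "instr list" where
  "rho_code = init_code @ multiply_code 3 @ coords_code 28 1 3 @ coords_code 37 2 4 @ [Print 5]"

lemma code_at_append: "length pre = n \<Longrightarrow> code_at (pre @ c @ post) n c"
  by (auto simp: code_at_def)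

lemma length_codes:
  "length init_code = 3" "length (multiply_code n) = 25" "length (coords_code n i j) = 9"
  "length invert_code = 6" "length (zero_test_code n) = 13"
  by (simp_all add: init_code_def multiply_code_def coords_code_def invert_code_def zero_test_code_def)

lemma code_at_rho_code:
  "code_at rho_code 0 init_code" "code_at rho_code 3 (multiply_code 3)"
  "code_at rho_code 28 (coords_code 28 1 3)" "code_at rho_code 37 (coords_code 37 2 4)"
  "code_at rho_code 46 [Print 5]" "length rho_code = 47"
  using code_at_append[of "[]"] code_at_append[of init_code]
    code_at_append[of "init_code @ multiply_code 3"]
    code_at_append[of "init_code @ multiply_code 3 @ coords_code 28 1 3"]
    code_at_append[of "init_code @ multiply_code 3 @ coords_code 28 1 3 @ coords_code 37 2 4" _ _ "[]"]
  by (simp_all add: rho_code_def length_codes)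

lemma rho_code_computes:
  "ram_outputs_within rho_code (encode_word w) (10 * length w + 23) (encode_rho_value (rho (braid_of w)))"
proof -
  obtain a b c d where M: "foldl mult_letter (1, 0, 0, 1) w = (a, b, c, d)"
    using prod_cases4 by blast
  have "det2 (a, b, c, d) = 1" by (simp flip: M add: det2_mult_letters)
  from encode_P1_moebius[OF this]
  have out: "encode_rho_value (rho (braid_of w)) =
      (homogeneous_coords a c @ homogeneous_coords b d) @ [letter_sum w]"
    by (simp add: rho_braid_of moebius_mult_letters moebius_one flip: M del: homogeneous_coords.simps)
  note code = code_at_rho_code
  have 1: "ram_leads rho_code 3 (\<lambda>s. s = ram_init (encode_word w))
      (ram_in 3 (1, 0, 0, 1) 0 (encode_word w) [])"
    using init_code[OF code(1)] by (simp add: loc_def)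
  have 2: "ram_leads rho_code (10 * length w + 5) (ram_in 3 (1, 0, 0, 1) 0 (encode_word w) [])
      (ram_in 28 (a, b, c, d) (letter_sum w) [] [])"
    using multiply_code_word[OF code(2), of w "(1, 0, 0, 1)" 0 "[]" "[]"] M by (simp add: loc_def)
  have 3: "ram_leads rho_code 7 (ram_in 28 (a, b, c, d) (letter_sum w) [] [])
      (\<lambda>s. \<exists>a' c'. ram_in 37 (a', b, c', d) (letter_sum w) [] (homogeneous_coords a c) s)"
    using coords_code_column1[OF code(3), of a b c d "letter_sum w" "[]" "[]"]
    by (simp add: loc_def del: homogeneous_coords.simps)
  have 4: "ram_leads rho_code 7
      (\<lambda>s. \<exists>a' c'. ram_in 37 (a', b, c', d) (letter_sum w) [] (homogeneous_coords a c) s)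
      (\<lambda>s. \<exists>M. ram_in 46 M (letter_sum w) [] (homogeneous_coords a c @ homogeneous_coords b d) s)"
  proof (intro ram_leads_ex)
    fix a' c'
    have "ram_leads rho_code 7 (ram_in 37 (a', b, c', d) (letter_sum w) [] (homogeneous_coords a c))
        (\<lambda>s. \<exists>b' d'. ram_in 46 (a', b', c', d') (letter_sum w) []
          (homogeneous_coords a c @ homogeneous_coords b d) s)"
      using coords_code_column2[OF code(4), of a' b c' d "letter_sum w" "[]" "homogeneous_coords a c"]
      by (simp add: loc_def del: homogeneous_coords.simps)
    then show "ram_leads rho_code 7
        (ram_in 37 (a', b, c', d) (letter_sum w) [] (homogeneous_coords a c))
        (\<lambda>s. \<exists>M. ram_in 46 M (letter_sum w) [] (homogeneous_coords a c @ homogeneous_coords b d) s)"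
      by (rule ram_leads_weaken) blast
  qed
  have 5: "ram_leads rho_code 1
      (\<lambda>s. \<exists>M. ram_in 46 M (letter_sum w) [] (homogeneous_coords a c @ homogeneous_coords b d) s)
      (\<lambda>s. ram_halted rho_code s \<and> ram_output s = encode_rho_value (rho (braid_of w)))"
  proof (intro ram_leads_ex ram_leadsI)
    fix M s
    assume s: "ram_in 46 M (letter_sum w) [] (homogeneous_coords a c @ homogeneous_coords b d) s"
    obtain a' b' c' d' where M: "M = (a', b', c', d')" by (cases M)
    have "ram_halted rho_code (ram_step rho_code s) \<and>
        ram_output (ram_step rho_code s) = encode_rho_value (rho (braid_of w))"
      using s ram_step_code[OF code(5), of 0] unfolding out
      by (cases s) (simp add: M loc_def ram_halted_def code(6) del: homogeneous_coords.simps)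
    then show "\<exists>k\<le>1. ram_halted rho_code ((ram_step rho_code ^^ k) s) \<and>
        ram_output ((ram_step rho_code ^^ k) s) = encode_rho_value (rho (braid_of w))"
      by (intro exI[of _ 1]) simp
  qed
  \<comment> \<open>The blocks take at most 3, \<open>10 * length w + 5\<close>, 7, 7 and 1
    steps.\<close>
  note steps = ram_leads_trans[OF _ ram_leads_trans[OF _ ram_leads_trans[OF _ ram_leads_trans]]]
  show ?thesis
    by (rule ram_outputs_withinI[OF steps[OF 1 2 3 4 5 HOL.refl HOL.refl HOL.refl HOL.refl]]) simp
qed

definition word_problem_code :: "instr list" where
  "word_problem_code = init_code @ multiply_code 3 @ invert_code @ multiply_code 34 @ zero_test_code 59"

lemma code_at_word_problem_code:
  "code_at word_problem_code 0 init_code" "code_at word_problem_code 3 (multiply_code 3)"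
  "code_at word_problem_code 28 invert_code" "code_at word_problem_code 34 (multiply_code 34)"
  "code_at word_problem_code 59 (zero_test_code 59)" "length word_problem_code = 72"
  using code_at_append[of "[]"] code_at_append[of init_code]
    code_at_append[of "init_code @ multiply_code 3"]
    code_at_append[of "init_code @ multiply_code 3 @ invert_code"]
    code_at_append[of "init_code @ multiply_code 3 @ invert_code @ multiply_code 34" _ _ "[]"]
  by (simp_all add: word_problem_code_def length_codes)

text \<open>The matrix belongs to the inverse of \<open>v\<close> followed by \<open>w\<close>, so
  it fixes an end exactly when \<open>v\<close> and \<open>w\<close> agree there. Being diagonal
  with equal exponent sums thus means equal values of \<open>rho\<close>, and injectivity
  concludes.\<close>

lemma word_problem_matrix:
  assumes "foldl mult_letter (adjugate (foldl mult_letter (1, 0, 0, 1) v)) w = (a, b, c, d)"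
  shows "b = 0 \<and> c = 0 \<and> letter_sum w - letter_sum v = 0 \<longleftrightarrow> braid_of v = braid_of w"
proof -
  let ?M = "foldl mult_letter (1, 0, 0, 1) v"
  have M: "det2 ?M = 1" "moebius ?M z = P1_acts v z" for z
    by (simp_all add: det2_mult_letters moebius_mult_letters moebius_one)
  then have "det2 (adjugate ?M) = 1" by (cases ?M) (simp add: algebra_simps)
  then have "det2 (a, b, c, d) = 1" by (metis assms det2_mult_letters)
  moreover have "moebius (a, b, c, d) z = z \<longleftrightarrow> P1_acts v z = P1_acts w z" for z
    using moebius_adjugate_eq_iff[OF M(1)] M(2) by (simp add: moebius_mult_letters flip: assms)
  ultimately have "b = 0 \<longleftrightarrow> P1_acts v (Fin 0) = P1_acts w (Fin 0)"
    "c = 0 \<longleftrightarrow> P1_acts v Infty = P1_acts w Infty"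
    using moebius_fixes_ends by metis+
  then show ?thesis
    by (auto simp: rho_braid_of simp flip: rho_braid_of_eq_iff)
qed

lemma word_problem_code_computes:
  "ram_outputs_within word_problem_code (encode_word v @ encode_word w)
    (10 * (length v + length w) + 30) [if braid_of v = braid_of w then 1 else 0]"
proof -
  let ?P = word_problem_code and ?M = "foldl mult_letter (1, 0, 0, 1) v"
  let ?e = "letter_sum w - letter_sum v"
  obtain a b c d where N: "foldl mult_letter (adjugate ?M) w = (a, b, c, d)"
    using prod_cases4 by blast
  note code = code_at_word_problem_code
  have 1: "ram_leads ?P 3 (\<lambda>s. s = ram_init (encode_word v @ encode_word w))
      (ram_in 3 (1, 0, 0, 1) 0 (encode_word v @ encode_word w) [])"
    using init_code[OF code(1)] by (simp add: loc_def)
  have 2: "ram_leads ?P (10 * length v + 5) (ram_in 3 (1, 0, 0, 1) 0 (encode_word v @ encode_word w) [])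
      (ram_in 28 ?M (letter_sum v) (encode_word w) [])"
    using multiply_code_word[OF code(2), of v "(1, 0, 0, 1)" 0 "encode_word w" "[]"]
    by (simp add: loc_def)
  have 3: "ram_leads ?P 6 (ram_in 28 ?M (letter_sum v) (encode_word w) [])
      (ram_in 34 (adjugate ?M) (- letter_sum v) (encode_word w) [])"
    using invert_code[OF code(3), of ?M "letter_sum v" "encode_word w" "[]"] by (simp add: loc_def)
  have 4: "ram_leads ?P (10 * length w + 5)
      (ram_in 34 (adjugate ?M) (- letter_sum v) (encode_word w) [])
      (ram_in 59 (a, b, c, d) ?e [] [])"
    using multiply_code_word[OF code(4), of w "adjugate ?M" "- letter_sum v" "[]" "[]"] N
    by (simp add: loc_def)
  have 5: "ram_leads ?P 11 (ram_in 59 (a, b, c, d) ?e [] [])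
      (\<lambda>s. ram_halted ?P s \<and> ram_output s = [if braid_of v = braid_of w then 1 else 0])"
    using zero_test_code[OF code(5), of a b c d ?e "[]" "[]"]
    unfolding word_problem_matrix[OF N] ram_leads_def loc_def ram_halted_def code(6) by force
  \<comment> \<open>The blocks take at most 3, \<open>10 * length v + 5\<close>, 6,
    \<open>10 * length w + 5\<close> and 11 steps.\<close>
  note steps = ram_leads_trans[OF _ ram_leads_trans[OF _ ram_leads_trans[OF _ ram_leads_trans]]]
  show ?thesis
    by (rule ram_outputs_withinI[OF steps[OF 1 2 3 4 5 HOL.refl HOL.refl HOL.refl HOL.refl]]) simp
qed

lemma computable_in_linear_timeI:
  assumes "\<And>x. ram_outputs_within P (enc x) (p * sz x + q) (ans x)"
  shows "computable_in_linear_time enc sz ans"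
proof -
  \<comment> \<open>The additive constant is absorbed only for positive \<open>L\<close>, which is
    enough for an asymptotic bound.\<close>
  have "p * L + q \<le> (p + q) * L" if "1 \<le> L" for L
    using that by (simp add: distrib_right)
  then have "real (p * L + q) \<le> real (p + q) * real L" if "1 \<le> L" for L
    using that by (metis of_nat_mono of_nat_mult)
  then have "(\<lambda>L. real (p * L + q)) \<in> O(\<lambda>L. real L)"
    by (intro bigoI[of _ "real (p + q)"] eventually_sequentiallyI[of 1]) simp
  then show ?thesis
    using assms unfolding computable_in_linear_time_def
    by (intro exI[of _ P] exI[of _ "\<lambda>L. p * L + q"]) simp
qed

theorem theorem1p1:
  shows "inj_on rho (carrier B3)
    \<and> computable_in_linear_time encode_word length
        (\<lambda>w. encode_rho_value (rho (braid_of w)))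
    \<and> computable_in_linear_time
        (\<lambda>(v, w). encode_word v @ encode_word w)
        (\<lambda>(v, w). length v + length w)
        (\<lambda>(v, w). [if braid_of v = braid_of w then 1 else 0])"
proof (intro conjI)
  show "inj_on rho (carrier B3)" by (rule inj_on_rho)
  show "computable_in_linear_time encode_word length (\<lambda>w. encode_rho_value (rho (braid_of w)))"
    using rho_code_computes by (rule computable_in_linear_timeI)
  show "computable_in_linear_time (\<lambda>(v, w). encode_word v @ encode_word w)
      (\<lambda>(v, w). length v + length w) (\<lambda>(v, w). [if braid_of v = braid_of w then 1 else 0])"
    by (rule computable_in_linear_timeI[of word_problem_code _ 10 _ 30])
      (use word_problem_code_computes in \<open>auto simp: case_prod_beta\<close>)
qed

end
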